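(* Let $d\ge 2$ be an integer. There exist $\varepsilon>0$ and $N$ such that for all integers $2\leq a_1\leq\dots\leq a_{d-1}$ with $a_1\geq N$ and $a_{d-1}\leq(1+\varepsilon)a_1$, the Turan algebra $A=TA(a_1,\dots,a_{d-1})$ has totally non-unimodal Hilbert vector, that is, $$\dim_{\mathbb{K}} A_1>\dim_{\mathbb{K}} A_2>\dots>\dim_{\mathbb{K}} A_{\lfloor d/2\rfloor}.$$
   Context: $\mathbb{K}$ is a field of characteristic $0$. A simplicial complex on a finite vertex set is a collection of subsets (faces) closed under taking subsets; facets are the maximal faces; it is homogeneous of dimension $d-2$ if all facets have $d-1$ elements. Turan complex: for integers $2\le a_1\le\dots\le a_{d-1}$, the Turan complex $\mathcal{TK}(a_1,\dots,a_{d-1})$ is the homogeneous simplicial complex of dimension $d-2$ whose set of facets is the cartesian product $\prod_{i=1}^{d-1}\{1,2,\dots,a_i\}$, where the sets $\{1,\dots,a_i\}$ for different $i$ are regarded as disjoint sets of vertices. That is, the vertex set is the disjoint union of $d-1$ sets of cardinalities $a_1,\dots,a_{d-1}$, and a facet consists of exactly one vertex from each of these sets. Associated algebra: let $\Delta$ be a homogeneous simplicial complex of dimension $d-2$ with vertices $u_1,\dots,u_m$, and let $g_1,\dots,g_n\in\mathbb{K}[u_1,\dots,u_m]_{d-1}$ be the square-free monomials $\prod_{u_j\in F}u_j$ of its facets $F$. Put $f_\Delta=\sum_{i=1}^n x_ig_i\in R=\mathbb{K}[x_1,\dots,x_n,u_1,\dots,u_m]$. Let $Q=\mathbb{K}[X_1,\dots,X_n,U_1,\dots,U_m]$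 act on $R$ by $X_i=\partial/\partial x_i$, $U_j=\partial/\partial u_j$, and let $\operatorname{Ann}_Q(f)=\{p\in Q: p(f)=0\}$. The associated algebra is $A_\Delta=Q/\operatorname{Ann}_Q(f_\Delta)$, a standard graded Artinian Gorenstein algebra $\bigoplus_{k=0}^dA_k$ of socle degree $d$ (grading by total degree). The Turan algebra $TA(a_1,\dots,a_{d-1})$ is the algebra associated to $\Delta=\mathcal{TK}(a_1,\dots,a_{d-1})$. *)

theory Defs
  imports
    Complex_Main
    "HOL-Library.Poly_Mapping"
    "HOL-Algebra.Algebraic_Closure_Type"
    "HOL-Algebra.Embedded_Algebras"
begin

section \<open>Simplicial complexes and the Turan complex\<close>

definition simplicial_complex :: "'a set \<Rightarrow> 'a set set \<Rightarrow> bool" where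
  "simplicial_complex V \<Delta> \<longleftrightarrow>
     finite V \<and> \<Delta> \<subseteq> Pow V \<and> (\<forall>F\<in>\<Delta>. \<forall>G. G \<subseteq> F \<longrightarrow> G \<in> \<Delta>)"

definition facets :: "'a set set \<Rightarrow> 'a set set" where
  "facets \<Delta> = {F \<in> \<Delta>. \<forall>G\<in>\<Delta>. F \<subseteq> G \<longrightarrow> G = F}"

text \<open>The vertex \<open>(i, j)\<close> is the element \<open>j\<close> of the \<open>i\<close>-th of the \<open>n\<close> disjoint sets
  \<open>{1..a 1}, \<dots>, {1..a n}\<close>; a point of their cartesian product is identified with its graph.\<close>

definition turan_vertices :: "nat \<Rightarrow> (nat \<Rightarrow> nat) \<Rightarrow> (nat \<times> nat) set" where
  "turan_vertices n a = (SIGMA i:{1..n}. {1..a i})"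

definition turan_facets :: "nat \<Rightarrow> (nat \<Rightarrow> nat) \<Rightarrow> (nat \<times> nat) set set" where
  "turan_facets n a = (\<lambda>\<phi>. (\<lambda>i. (i, \<phi> i)) ` {1..n}) ` (\<Pi>\<^sub>E i\<in>{1..n}. {1..a i})"

definition turan_complex :: "nat \<Rightarrow> (nat \<Rightarrow> nat) \<Rightarrow> (nat \<times> nat) set set" where
  "turan_complex n a = {F. \<exists>G\<in>turan_facets n a. F \<subseteq> G}"

lemma card_turan_facet: "F \<in> turan_facets n a \<Longrightarrow> finite F \<and> card F = n"
  by (auto simp: turan_facets_def card_image inj_on_def)

lemma simplicial_complex_turan: "simplicial_complex (turan_vertices n a) (turan_complex n a)"
proof -
  have "F \<subseteq> turan_vertices n a" if "F \<in> turan_facets n a" for F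
    using that by (auto simp: turan_facets_def turan_vertices_def dest: PiE_mem)
  then show ?thesis
    unfolding simplicial_complex_def turan_complex_def
    by (auto simp: turan_vertices_def intro: subset_trans) blast+
qed

lemma facets_turan_complex: "facets (turan_complex n a) = turan_facets n a"
proof
  show "facets (turan_complex n a) \<subseteq> turan_facets n a"
    by (auto simp: facets_def turan_complex_def)
  show "turan_facets n a \<subseteq> facets (turan_complex n a)"
  proof
    fix F assume F: "F \<in> turan_facets n a"
    have "G = F" if "H \<in> turan_facets n a" "G \<subseteq> H" "F \<subseteq> G" for G H
      using that F card_turan_facet by (metis card_subset_eq subset_antisym subset_trans)
    then show "F \<in> facets (turan_complex n a)"
      using F by (auto simp: facets_def turan_complex_def)
  qed
qed


section \<open>Polynomials acting by differentiation\<close>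

type_synonym ('v, 'k) mpoly = "('v \<Rightarrow>\<^sub>0 nat) \<Rightarrow>\<^sub>0 'k"

definition mvar :: "'v \<Rightarrow> ('v, 'k::comm_ring_1) mpoly" where
  "mvar v = Poly_Mapping.single (Poly_Mapping.single v 1) 1"

definition mconst :: "'k \<Rightarrow> ('v, 'k::comm_ring_1) mpoly" where
  "mconst c = Poly_Mapping.single 0 c"

definition mvars :: "('v, 'k::comm_ring_1) mpoly \<Rightarrow> 'v set" where
  "mvars p = (\<Union>m\<in>Poly_Mapping.keys p. Poly_Mapping.keys m)"

definition mono_degree :: "('v \<Rightarrow>\<^sub>0 nat) \<Rightarrow> nat" where
  "mono_degree m = (\<Sum>v\<in>Poly_Mapping.keys m. Poly_Mapping.lookup m v)"

text \<open>Monomials in which \<open>v\<close> does not occur contribute coefficient \<open>0\<close>, so the truncated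
  subtraction of exponents is harmless.\<close>

definition mpderiv :: "'v \<Rightarrow> ('v, 'k) mpoly \<Rightarrow> ('v, 'k::comm_ring_1) mpoly" where
  "mpderiv v p = (\<Sum>m\<in>Poly_Mapping.keys p. Poly_Mapping.single (m - Poly_Mapping.single v 1)
     (of_nat (Poly_Mapping.lookup m v) * Poly_Mapping.lookup p m))"

text \<open>The iterated partial derivative given by a monomial. The order of composition is
  irrelevant, as the operators \<open>mpderiv v\<close> commute.\<close>

definition mono_deriv :: "('v \<Rightarrow>\<^sub>0 nat) \<Rightarrow> ('v, 'k) mpoly \<Rightarrow> ('v, 'k::comm_ring_1) mpoly" where
  "mono_deriv m f =
     Finite_Set.fold (\<lambda>v. mpderiv v ^^ Poly_Mapping.lookup m v) f (Poly_Mapping.keys m)"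

definition diff_act :: "('v, 'k) mpoly \<Rightarrow> ('v, 'k) mpoly \<Rightarrow> ('v, 'k::comm_ring_1) mpoly" where
  "diff_act q f = (\<Sum>m\<in>Poly_Mapping.keys q. mconst (Poly_Mapping.lookup q m) * mono_deriv m f)"


section \<open>The algebra attached to a polynomial\<close>

text \<open>The polynomial ring over \<open>'k\<close> in the variables \<open>V\<close>; it serves both as \<open>R\<close> and as the ring
  \<open>Q\<close> of differential operators.\<close>

definition mpoly_ring :: "'v set \<Rightarrow> ('v, 'k::comm_ring_1) mpoly ring" where
  "mpoly_ring V = ring_of_type_algebra \<lparr>carrier := {p. mvars p \<subseteq> V}\<rparr>"

definition annihilator :: "'v set \<Rightarrow> ('v, 'k::comm_ring_1) mpoly \<Rightarrow> ('v, 'k) mpoly set" where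
  "annihilator V f = {p \<in> carrier (mpoly_ring V). diff_act p f = 0}"

definition gorenstein_algebra ::
    "'v set \<Rightarrow> ('v, 'k::comm_ring_1) mpoly \<Rightarrow> ('v, 'k) mpoly set ring" where
  "gorenstein_algebra V f = mpoly_ring V Quot annihilator V f"

definition residue_class ::
    "'v set \<Rightarrow> ('v, 'k::comm_ring_1) mpoly \<Rightarrow> ('v, 'k) mpoly \<Rightarrow> ('v, 'k) mpoly set" where
  "residue_class V f p = annihilator V f +>\<^bsub>mpoly_ring V\<^esub> p"

text \<open>The copy of the ground field inside the algebra, over which dimensions are taken.\<close>

definition algebra_scalars ::
    "'v set \<Rightarrow> ('v, 'k::comm_ring_1) mpoly \<Rightarrow> ('v, 'k) mpoly set set" where
  "algebra_scalars V f = (\<lambda>c. residue_class V f (mconst c)) ` UNIV"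

definition homogeneous_polys :: "'v set \<Rightarrow> nat \<Rightarrow> ('v, 'k::comm_ring_1) mpoly set" where
  "homogeneous_polys V k =
     {p \<in> carrier (mpoly_ring V). \<forall>m\<in>Poly_Mapping.keys p. mono_degree m = k}"

definition algebra_component ::
    "'v set \<Rightarrow> ('v, 'k::comm_ring_1) mpoly \<Rightarrow> nat \<Rightarrow> ('v, 'k) mpoly set set" where
  "algebra_component V f k = residue_class V f ` homogeneous_polys V k"

definition hilbert_function :: "'v set \<Rightarrow> ('v, 'k::comm_ring_1) mpoly \<Rightarrow> nat \<Rightarrow> nat" where
  "hilbert_function V f k =
     ring.dim (gorenstein_algebra V f) (algebra_scalars V f) (algebra_component V f k)"


section \<open>The algebra associated to a simplicial complex\<close>

text \<open>The variables \<open>x\<^sub>1, \<dots>, x\<^sub>n\<close> are indexed by the facets themselves, and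
  \<open>u\<^sub>1, \<dots>, u\<^sub>m\<close> by the vertices.\<close>

datatype 'a cvar = FacetVar "'a set" | VertexVar 'a

definition complex_vars :: "'a set \<Rightarrow> 'a set set \<Rightarrow> 'a cvar set" where
  "complex_vars V \<Delta> = FacetVar ` facets \<Delta> \<union> VertexVar ` V"

definition complex_poly :: "'a set set \<Rightarrow> ('a cvar, 'k::comm_ring_1) mpoly" where
  "complex_poly \<Delta> = (\<Sum>F\<in>facets \<Delta>. mvar (FacetVar F) * (\<Prod>u\<in>F. mvar (VertexVar u)))"

definition complex_hilbert ::
    "'k::field_char_0 itself \<Rightarrow> 'a set \<Rightarrow> 'a set set \<Rightarrow> nat \<Rightarrow> nat" where
  "complex_hilbert _ V \<Delta> =
     hilbert_function (complex_vars V \<Delta>) (complex_poly \<Delta> :: ('a cvar, 'k) mpoly)"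

text \<open>\<open>dim\<^sub>K A\<^sub>k\<close> for \<open>A = TA(a 1, \<dots>, a n)\<close>, whose socle degree is \<open>n + 1\<close>.\<close>

definition turan_hilbert :: "'k::field_char_0 itself \<Rightarrow> nat \<Rightarrow> (nat \<Rightarrow> nat) \<Rightarrow> nat \<Rightarrow> nat" where
  "turan_hilbert K n a = complex_hilbert K (turan_vertices n a) (turan_complex n a)"


section \<open>Well-definedness\<close>

text \<open>\<open>diff_act\<close> makes the polynomial ring a module over itself in which a variable acts as the
  corresponding partial derivative. Hence annihilators are ideals, the quotients are commutative
  rings, and (for a nonzero polynomial) the scalars form a subfield, so that \<open>ring.dim\<close> is applied
  in its intended setting.\<close>

lemma lookup_mpderiv: "Poly_Mapping.lookup (mpderiv v p) m =
     of_nat (Suc (Poly_Mapping.lookup m v)) * Poly_Mapping.lookup p (m + Poly_Mapping.single v 1)"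
proof -
  have *: "(Poly_Mapping.lookup (Poly_Mapping.single (k - Poly_Mapping.single v 1)
       (of_nat (Poly_Mapping.lookup k v) * Poly_Mapping.lookup p k)) m)
     = (if k = m + Poly_Mapping.single v 1 then of_nat (Suc (Poly_Mapping.lookup m v)) * Poly_Mapping.lookup p k else 0)" for k
  proof (cases "Poly_Mapping.lookup k v = 0")
    case True
    then have "k \<noteq> m + Poly_Mapping.single v 1"
      by (metis Zero_not_Suc add_Suc_right lookup_add lookup_single_eq One_nat_def)
    with True show ?thesis by simp
  next
    case False
    have "k - Poly_Mapping.single v 1 = m \<longleftrightarrow> k = m + Poly_Mapping.single v 1"
    proof
      assume "k - Poly_Mapping.single v 1 = m"
      then show "k = m + Poly_Mapping.single v 1"
        using False by (intro poly_mapping_eqI) (auto simp: lookup_add lookup_minus lookup_single when_def)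
    qed simp
    then show ?thesis using False
      by (auto simp: lookup_single when_def lookup_add)
  qed
  show ?thesis
    unfolding mpderiv_def lookup_sum *
    by (auto simp: sum.delta' sum.delta in_keys_iff)
qed

lemma mpderiv_commute: "mpderiv v (mpderiv w p) = mpderiv w (mpderiv v p)"
  by (rule poly_mapping_eqI)
    (auto simp: lookup_mpderiv lookup_add lookup_single when_def algebra_simps)

lemma funpow_mpderiv_commute:
  "(mpderiv y ^^ m) ((mpderiv x ^^ n) p) = (mpderiv x ^^ n) ((mpderiv y ^^ m) p)"
proof -
  have 1: "(mpderiv y ^^ m) (mpderiv x p) = mpderiv x ((mpderiv y ^^ m) p)" for p
    by (induction m) (auto simp: mpderiv_commute[of x])
  show ?thesis by (induction n) (auto simp: 1)
qed

interpretation mpderiv: comp_fun_commute "\<lambda>v. mpderiv v ^^ e v" for e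
  by standard (auto simp: fun_eq_iff funpow_mpderiv_commute)

lemma mono_deriv_superset:
  assumes "finite S" "Poly_Mapping.keys m \<subseteq> S"
  shows "mono_deriv m f = Finite_Set.fold (\<lambda>v. mpderiv v ^^ Poly_Mapping.lookup m v) f S"
proof -
  have "Finite_Set.fold (\<lambda>v. mpderiv v ^^ Poly_Mapping.lookup m v) f (Poly_Mapping.keys m \<union> T) = mono_deriv m f"
    if "finite T" "T \<inter> Poly_Mapping.keys m = {}" for T
    using that
    by (induction T) (auto simp: mono_deriv_def in_keys_iff)
  from this[of "S - Poly_Mapping.keys m"] assms show ?thesis by (simp add: Un_absorb1 Int_commute)
qed

lemma mono_deriv_add: "mono_deriv (m + n) f = mono_deriv m (mono_deriv n f)"
proof -
  let ?S = "Poly_Mapping.keys m \<union> Poly_Mapping.keys n"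
  let ?l = Poly_Mapping.lookup
  have "Finite_Set.fold (\<lambda>v. mpderiv v ^^ ?l (m + n) v) f S
     = Finite_Set.fold (\<lambda>v. mpderiv v ^^ ?l m v) (Finite_Set.fold (\<lambda>v. mpderiv v ^^ ?l n v) f S) S" if "finite S" for S
    using that
  proof (induction S)
    case (insert x S)
    have "Finite_Set.fold (\<lambda>v. mpderiv v ^^ ?l m v) ((mpderiv x ^^ k) g) S =
       (mpderiv x ^^ k) (Finite_Set.fold (\<lambda>v. mpderiv v ^^ ?l m v) g S)" for k and g :: "('a,'b) mpoly"
      using insert.hyps(1) by (induction S) (auto simp: funpow_mpderiv_commute)
    note comm = this
    show ?case
      unfolding mpderiv.fold_insert[OF insert.hyps] insert.IH
      by (simp only: lookup_add funpow_add comm o_apply)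
  qed simp
  then show ?thesis
    using Poly_Mapping.keys_add[of m n] by (simp add: mono_deriv_superset[of ?S])
qed

lemma mpderiv_add: "mpderiv v (f + g) = mpderiv v f + mpderiv v g"
  by (rule poly_mapping_eqI) (simp only: lookup_mpderiv lookup_add distrib_left)

lemma lookup_mconst_mult: "Poly_Mapping.lookup (mconst c * p) m = c * Poly_Mapping.lookup p m"
  unfolding mconst_def by (subst mult_map_scale_conv_mult[symmetric]) (simp add: Poly_Mapping.map.rep_eq when_def in_keys_iff) 

lemma mpderiv_scale: "mpderiv v (mconst c * f) = mconst c * mpderiv v f"
  by (rule poly_mapping_eqI) (simp only: lookup_mpderiv lookup_mconst_mult mult.left_commute)

lemma mono_deriv_lin: "mono_deriv m (f + g) = mono_deriv m f + mono_deriv m g"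
   "mono_deriv m (mconst c * f) = mconst c * mono_deriv m f"
proof -
  have 1: "(mpderiv v ^^ k) (f + g) = (mpderiv v ^^ k) f + (mpderiv v ^^ k) g" for v k and f g :: "('a,'b) mpoly"
    by (induction k) (auto simp: mpderiv_add)
  have 2: "(mpderiv v ^^ k) (mconst c * f) = mconst c * (mpderiv v ^^ k) f" for v k and f g :: "('a,'b) mpoly"
    by (induction k) (auto simp: mpderiv_scale)
  have "finite S \<Longrightarrow> Finite_Set.fold (\<lambda>v. mpderiv v ^^ Poly_Mapping.lookup m v) (f+g) S =
    Finite_Set.fold (\<lambda>v. mpderiv v ^^ Poly_Mapping.lookup m v) f S + Finite_Set.fold (\<lambda>v. mpderiv v ^^ Poly_Mapping.lookup m v) g S" for S
    by (induction S rule: finite_induct) (auto simp: 1)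
  moreover have "finite S \<Longrightarrow> Finite_Set.fold (\<lambda>v. mpderiv v ^^ Poly_Mapping.lookup m v) (mconst c * f) S =
    mconst c * Finite_Set.fold (\<lambda>v. mpderiv v ^^ Poly_Mapping.lookup m v) f S" for S
    by (induction S rule: finite_induct) (auto simp: 2)
  ultimately show "mono_deriv m (f + g) = mono_deriv m f + mono_deriv m g"
   "mono_deriv m (mconst c * f) = mconst c * mono_deriv m f"
    unfolding mono_deriv_def by auto
qed


lemma mconst_simps: "mconst 0 = 0" "mconst 1 = 1" "mconst (a + b) = mconst a + mconst b"
   "mconst (a * b) = mconst a * mconst b" "mconst (- a) = - mconst a"
  by (simp_all add: mconst_def single_add mult_single single_uminus)

lemma diff_act_superset:
  assumes "finite S" "Poly_Mapping.keys q \<subseteq> S"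
  shows "diff_act q f = (\<Sum>m\<in>S. mconst (Poly_Mapping.lookup q m) * mono_deriv m f)"
  unfolding diff_act_def
  by (rule sum.mono_neutral_left) (use assms in \<open>auto simp: in_keys_iff mconst_simps\<close>)

lemma diff_act_add_left: "diff_act (p + q) f = diff_act p f + diff_act q f"
proof -
  let ?S = "Poly_Mapping.keys p \<union> Poly_Mapping.keys q"
  have "Poly_Mapping.keys (p + q) \<subseteq> ?S" by (rule Poly_Mapping.keys_add)
  then show ?thesis
    by (simp add: diff_act_superset[of ?S] lookup_add mconst_simps distrib_right sum.distrib)
qed

lemma diff_act_single: "diff_act (Poly_Mapping.single m c) f = mconst c * mono_deriv m f"
  by (subst diff_act_superset[of "{m}"]) auto

lemma diff_act_mvar: "diff_act (mvar v) f = mpderiv v f"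
  by (simp add: mvar_def diff_act_single mono_deriv_def mconst_simps)

lemma diff_act_lin: "diff_act q (f + g) = diff_act q f + diff_act q g"
   "diff_act q (mconst c * f) = mconst c * diff_act q f"
  by (simp_all add: diff_act_def mono_deriv_lin distrib_left sum.distrib sum_distrib_left mult.left_commute)

lemma mpoly_induct [case_names single sum]:
  assumes "\<And>m c. P (Poly_Mapping.single m c)" "\<And>p q. P p \<Longrightarrow> P q \<Longrightarrow> P (p + q)"
  shows "P p"
proof (induction p rule: update_induct)
  case const
  show ?case using assms(1)[of _ 0] by simp
next
  case (update p m c)
  have "Poly_Mapping.update m c p = p + Poly_Mapping.single m c"
    using update by (intro poly_mapping_eqI) (auto simp: lookup_update lookup_add lookup_single in_keys_iff when_def)
  with update assms show ?case by simp
qed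

lemma diff_act_mult: "diff_act (p * q) f = diff_act p (diff_act q f)"
proof (induction p rule: mpoly_induct)
  case (single k v)
  show ?case
  proof (induction q rule: mpoly_induct)
    case (single l w)
    show ?case by (simp add: mult_single diff_act_single mono_deriv_add mconst_simps mono_deriv_lin mult.assoc)
  next
    case (sum q1 q2) then show ?case by (simp add: distrib_left diff_act_add_left diff_act_lin)
  qed
next
  case (sum q1 q2) then show ?case by (simp add: distrib_right diff_act_add_left)
qed

lemma diff_act_1: "diff_act 1 f = f"
  using diff_act_single[of 0 1 f] by (simp add: mono_deriv_def mconst_simps)
lemma diff_act_0: "diff_act q 0 = 0" using diff_act_lin(2)[of q 0] by (simp add: mconst_simps)
lemma diff_act_0l: "diff_act 0 q = 0" by (simp add: diff_act_def)

lemma mvars_simps: "mvars 0 = {}" "mvars 1 = {}" "mvars (mconst c) = {}" "mvars (p+q) \<subseteq> mvars p \<union> mvars q" "mvars (-p) = mvars p"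
    "mvars (p*q) \<subseteq> mvars p \<union> mvars q"
proof -
  show  "mvars 0 = {}" "mvars 1 = {}" "mvars (mconst c) = {}" "mvars (-p) = mvars p" by (auto simp: mvars_def mconst_def)
  show "mvars (p+q) \<subseteq> mvars p \<union> mvars q" unfolding mvars_def using Poly_Mapping.keys_add[of p q] by blast
  show "mvars (p*q) \<subseteq> mvars p \<union> mvars q" 
  proof
    fix v assume "v \<in> mvars (p * q)"
    then obtain m where m: "m \<in> Poly_Mapping.keys (p * q)" "v \<in> Poly_Mapping.keys m"
      by (auto simp: mvars_def)
    then obtain a b where "m = a + b" "a \<in> Poly_Mapping.keys p" "b \<in> Poly_Mapping.keys q"
      using keys_mult[of p q] by blast
    then show "v \<in> mvars p \<union> mvars q"
      using m(2) Poly_Mapping.keys_add[of a b] by (auto simp: mvars_def)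
  qed
qed

lemma mpoly_ring_simps: "carrier (mpoly_ring V) = {p. mvars p \<subseteq> V}" "monoid.mult (mpoly_ring V) = (*)" "add (mpoly_ring V) = (+)" "monoid.one (mpoly_ring V) = 1"  "ring.zero (mpoly_ring V) = 0"
  by (auto simp: mpoly_ring_def ring_of_type_algebra_def)

lemma cring_mpoly_ring: "cring (mpoly_ring V :: ('v,'k::comm_ring_1) mpoly ring)"
proof (intro cringI abelian_groupI comm_monoidI)
  show "\<exists>y\<in>carrier (mpoly_ring V). y \<oplus>\<^bsub>mpoly_ring V\<^esub> x = \<zero>\<^bsub>mpoly_ring V\<^esub>" if "x \<in> carrier (mpoly_ring V)" for x :: "('v,'k::comm_ring_1) mpoly"
    by (rule bexI[of _ "- x"]) (use that in \<open>auto simp: mpoly_ring_simps mvars_simps\<close>)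
next
  fix p q :: "('v,'k) mpoly" assume "p \<in> carrier (mpoly_ring V)" "q \<in> carrier (mpoly_ring V)"
  then show "p \<oplus>\<^bsub>mpoly_ring V\<^esub> q \<in> carrier (mpoly_ring V)" "p \<otimes>\<^bsub>mpoly_ring V\<^esub> q \<in> carrier (mpoly_ring V)"
    using mvars_simps(4,6)[of p q] by (auto simp: mpoly_ring_simps)
qed (simp_all add: mpoly_ring_simps mvars_simps ac_simps distrib_left distrib_right)

lemma ideal_annihilator: "ideal (annihilator V f) (mpoly_ring V)"
proof -
  interpret cring "mpoly_ring V :: ('a,'b) mpoly ring" by (rule cring_mpoly_ring)
  have u: "a_inv (mpoly_ring V) p = - p" if "p \<in> carrier (mpoly_ring V)" for p :: "('a,'b) mpoly"
    using that by (intro minus_equality) (auto simp: mpoly_ring_simps mvars_simps)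
  have n: "diff_act (- p) f = - diff_act p f" for p :: "('a,'b) mpoly" 
    by (metis add.right_inverse diff_act_0l diff_act_add_left neg_eq_iff_add_eq_0 add_eq_0_iff)
  have s: "subgroup (annihilator V f) (add_monoid (mpoly_ring V))"
  proof (rule add.subgroupI)
    show "annihilator V f \<noteq> {}"
      using mvars_simps(1) diff_act_0l by (auto simp: annihilator_def mpoly_ring_simps intro!: exI[of _ 0])
  next
    fix p q assume "p \<in> annihilator V f" "q \<in> annihilator V f"
    then show "p \<oplus>\<^bsub>mpoly_ring V\<^esub> q \<in> annihilator V f"
      using mvars_simps(4)[of p q] by (auto simp: annihilator_def mpoly_ring_simps diff_act_add_left)
  qed (use u n in \<open>auto simp: annihilator_def mpoly_ring_simps mvars_simps a_inv_def\<close>)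
  show ?thesis
  proof (rule idealI[OF ring_axioms s])
    fix p q :: "('a,'b) mpoly" assume "p \<in> annihilator V f" "q \<in> carrier (mpoly_ring V)"
    then have "q * p \<in> annihilator V f"
      using mvars_simps(6)[of q p] by (auto simp: annihilator_def mpoly_ring_simps diff_act_mult diff_act_0)
    then show "q \<otimes>\<^bsub>mpoly_ring V\<^esub> p \<in> annihilator V f" "p \<otimes>\<^bsub>mpoly_ring V\<^esub> q \<in> annihilator V f"
      by (simp_all add: mpoly_ring_simps mult.commute[of p q])
  qed
qed

lemma cring_gorenstein_algebra: "cring (gorenstein_algebra V f)"
  unfolding gorenstein_algebra_def by (rule ideal.quotient_is_cring[OF ideal_annihilator cring_mpoly_ring])

lemma subfield_algebra_scalars:
  fixes f :: "('v, 'k::field) mpoly"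
  assumes "f \<noteq> 0"
  shows "subfield (algebra_scalars V f) (gorenstein_algebra V f)"
proof -
  have 1: "1 \<notin> annihilator V f" using assms diff_act_1[of f] by (simp add: annihilator_def)
  interpret I: ideal "annihilator V f" "mpoly_ring V" by (rule ideal_annihilator)
  interpret G: cring "gorenstein_algebra V f" by (rule cring_gorenstein_algebra)
  have h1: "residue_class V f \<in> ring_hom (mpoly_ring V) (gorenstein_algebra V f)"
    unfolding gorenstein_algebra_def residue_class_def[abs_def] by (rule I.rcos_ring_hom)
  let ?K = "ring_of_type_algebra :: 'k ring"
  have "(mconst :: 'k \<Rightarrow> ('v, 'k) mpoly) \<in> ring_hom ?K (mpoly_ring V)"
    by (rule ring_hom_memI) (auto simp: mpoly_ring_simps ring_of_type_algebra_def mconst_simps mvars_simps)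
  from ring_hom_trans[OF this h1] have h: "residue_class V f \<circ> mconst \<in> ring_hom ?K (gorenstein_algebra V f)" .
  have K: "field ?K" by (rule field_from_type_algebra)
  have rg: "ring (gorenstein_algebra V f)" by (rule cring.axioms(1)[OF G.is_cring])
  have H: "ring_hom_ring ?K (gorenstein_algebra V f) (residue_class V f \<circ> mconst)"
    by (rule ring_hom_ringI2[OF cring.axioms(1)[OF domain.axioms(1)[OF field.axioms(1)[OF K]]] rg h])
  have "\<one>\<^bsub>gorenstein_algebra V f\<^esub> \<noteq> \<zero>\<^bsub>gorenstein_algebra V f\<^esub>"
  proof
    assume "\<one>\<^bsub>gorenstein_algebra V f\<^esub> = \<zero>\<^bsub>gorenstein_algebra V f\<^esub>"
    then have "annihilator V f +>\<^bsub>mpoly_ring V\<^esub> 1 = annihilator V f"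
      by (simp add: gorenstein_algebra_def FactRing_def mpoly_ring_simps)
    moreover have "1 \<in> annihilator V f +>\<^bsub>mpoly_ring V\<^esub> 1"
      by (rule I.a_rcos_self) (simp add: mpoly_ring_simps mvars_simps)
    ultimately show False using 1 by simp
  qed
  from ring_hom_ring.img_is_subfield(2)[OF H field.carrier_is_subfield[OF K] this]
  show ?thesis
    unfolding algebra_scalars_def comp_def ring_of_type_algebra_def partial_object.select_convs .
qed

end

theory Submission
  imports Defs
begin

text \<open>All derivatives of \<open>f\<^sub>\<Delta>\<close> by monomials are \<open>0\<close> or have coefficients \<open>0\<close> and \<open>1\<close>, and distinct
  derivatives of the same order have disjoint supports. Hence \<open>dim A\<^sub>k\<close> is the number of nonzero
  derivatives of order \<open>k\<close>. Such a derivative is either \<open>\<partial>\<^sub>S f\<^sub>\<Delta>\<close> for a face \<open>S\<close> with \<open>k\<close> vertices, or,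
  if one differentiates by a facet variable, the monomial of a face with \<open>d - k\<close> vertices. So
  \<open>dim A\<^sub>k\<close> is the sum of these two numbers of faces. A Turan complex with all \<open>a\<^sub>i\<close> between \<open>m\<close> and
  \<open>2 m\<close> has at least \<open>m\<^sup>j\<close> and at most \<open>(2 n m)\<^sup>j\<close> faces with \<open>j\<close> vertices, so for large \<open>m\<close>
  and \<open>k < d / 2\<close> the faces with \<open>d - k\<close> vertices outnumber all faces that contribute to
  \<open>dim A\<^sub>k\<^sub>+\<^sub>1\<close>.\<close>

section \<open>Dimensions from disjointly supported derivatives\<close>

lemma diff_act_uminus: "diff_act (- p) f = - diff_act p f"
  by (metis add.right_inverse diff_act_0l diff_act_add_left add_eq_0_iff)

lemma diff_act_sum: "diff_act (\<Sum>i\<in>I. p i) f = (\<Sum>i\<in>I. diff_act (p i) f)"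
  by (induction I rule: infinite_finite_induct) (simp_all add: diff_act_add_left diff_act_0l)

lemma a_inv_mpoly_ring:
  fixes p :: "('v, 'k::comm_ring_1) mpoly"
  assumes "p \<in> carrier (mpoly_ring V)"
  shows "\<ominus>\<^bsub>mpoly_ring V\<^esub> p = - p"
proof -
  interpret cring "mpoly_ring V :: ('v, 'k) mpoly ring" by (rule cring_mpoly_ring)
  show ?thesis
    using assms by (intro minus_equality) (auto simp: mpoly_ring_simps mvars_simps)
qed

text \<open>The action is additive in the operator, so \<open>p - q\<close> annihilates
  \<open>f\<close> exactly when \<open>p\<close> and \<open>q\<close> have the same effect on
  \<open>f\<close>. From here on the algebra is studied through derivatives of \<open>f\<close>
  instead of cosets.\<close>

lemma residue_class_eq_iff:
  fixes p q f :: "('v, 'k::comm_ring_1) mpoly"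
  assumes "p \<in> carrier (mpoly_ring V)" "q \<in> carrier (mpoly_ring V)"
  shows "residue_class V f p = residue_class V f q \<longleftrightarrow> diff_act p f = diff_act q f"
proof -
  interpret cring "mpoly_ring V :: ('v, 'k) mpoly ring" by (rule cring_mpoly_ring)
  have "p \<ominus>\<^bsub>mpoly_ring V\<^esub> q = p - q"
    using assms by (simp add: a_minus_def a_inv_mpoly_ring mpoly_ring_simps)
  moreover have "p \<ominus>\<^bsub>mpoly_ring V\<^esub> q \<in> carrier (mpoly_ring V)"
    using assms by simp
  moreover have "diff_act (p - q) f = diff_act p f - diff_act q f"
    using diff_act_add_left[of p "- q" f] by (simp add: diff_act_uminus)
  ultimately have "p \<ominus>\<^bsub>mpoly_ring V\<^esub> q \<in> annihilator V f \<longleftrightarrow> diff_act p f = diff_act q f"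
    by (simp add: annihilator_def)
  then show ?thesis
    unfolding residue_class_def
    using quotient_eq_iff_same_a_r_cos[OF ideal_annihilator assms] by blast
qed

lemma residue_class_hom:
  "residue_class V f \<in> ring_hom (mpoly_ring V) (gorenstein_algebra V f)"
proof -
  interpret I: ideal "annihilator V f" "mpoly_ring V" by (rule ideal_annihilator)
  show ?thesis
    unfolding gorenstein_algebra_def residue_class_def[abs_def] by (rule I.rcos_ring_hom)
qed

lemma keys_diff_act:
  "Poly_Mapping.keys (diff_act p f) \<subseteq>
     (\<Union>m\<in>Poly_Mapping.keys p. Poly_Mapping.keys (mono_deriv m f))"
proof -
  have "Poly_Mapping.keys (diff_act p f) \<subseteq>
      (\<Union>m\<in>Poly_Mapping.keys p. Poly_Mapping.keys (mconst (Poly_Mapping.lookup p m) * mono_deriv m f))"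
    unfolding diff_act_def by (rule keys_sum)
  also have "\<dots> \<subseteq> (\<Union>m\<in>Poly_Mapping.keys p. Poly_Mapping.keys (mono_deriv m f))"
    by (rule UN_mono) (auto simp: in_keys_iff lookup_mconst_mult)
  finally show ?thesis .
qed

text \<open>Disjoint nonempty supports force linear independence. The induction on \<open>B\<close>
  mirrors the inductive definition of dimension: each new monomial contributes one line
  extension.\<close>

lemma dimension_residue_classes:
  fixes f :: "('v, 'k::field) mpoly"
  assumes "finite B"
    and vars: "\<And>b. b \<in> B \<Longrightarrow> Poly_Mapping.keys b \<subseteq> V"
    and nonzero: "\<And>b. b \<in> B \<Longrightarrow> mono_deriv b f \<noteq> 0"
    and disjoint: "\<And>b c. b \<in> B \<Longrightarrow> c \<in> B \<Longrightarrow> b \<noteq> c \<Longrightarrow>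
      Poly_Mapping.keys (mono_deriv b f) \<inter> Poly_Mapping.keys (mono_deriv c f) = {}"
  shows "ring.dimension (gorenstein_algebra V f) (card B) (algebra_scalars V f)
           (residue_class V f ` {p. Poly_Mapping.keys p \<subseteq> B})"
proof -
  let ?Q = "mpoly_ring V :: ('v, 'k) mpoly ring"
  let ?G = "gorenstein_algebra V f" and ?r = "residue_class V f"
  interpret G: cring ?G by (rule cring_gorenstein_algebra)
  interpret Q: cring ?Q by (rule cring_mpoly_ring)
  interpret h: ring_hom_ring ?Q ?G ?r
    by (rule ring_hom_ringI2) (use residue_class_hom Q.ring_axioms G.ring_axioms in auto)
  have mconst_carrier: "mconst c \<in> carrier ?Q" for c
    by (simp add: mpoly_ring_simps mvars_simps)
  from assms show ?thesis
  proof (induction B rule: finite_induct)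
    case empty
    have "{p :: ('v, 'k) mpoly. Poly_Mapping.keys p \<subseteq> {}} = {\<zero>\<^bsub>?Q\<^esub>}"
      by (auto simp: mpoly_ring_simps)
    moreover have "?r \<zero>\<^bsub>?Q\<^esub> = \<zero>\<^bsub>?G\<^esub>" by (rule h.hom_zero)
    ultimately show ?case by (simp add: G.dimension.zero_dim)
  next
    case (insert b B)
    let ?E = "?r ` {p. Poly_Mapping.keys p \<subseteq> B}"
    let ?b = "Poly_Mapping.single b 1 :: ('v, 'k) mpoly"
    have carrier: "p \<in> carrier ?Q" if "Poly_Mapping.keys p \<subseteq> insert b B" for p
      using that insert.prems(1) by (force simp: mpoly_ring_simps mvars_def)
    have b_carrier: "?b \<in> carrier ?Q" by (rule carrier) simp
    \<comment> \<open>Otherwise \<open>mono_deriv b f\<close> would equal a combination of the other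
      derivatives, so its support would lie in a union of sets disjoint from it and be
      empty.\<close>
    have "?r ?b \<notin> ?E"
    proof
      assume "?r ?b \<in> ?E"
      then obtain p where p: "Poly_Mapping.keys p \<subseteq> B" "?r ?b = ?r p" by blast
      have "diff_act ?b f = diff_act p f"
        using p residue_class_eq_iff[OF b_carrier carrier, of p f] by blast
      then have *: "mono_deriv b f = diff_act p f"
        by (simp add: diff_act_single mconst_simps)
      then have "Poly_Mapping.keys (mono_deriv b f) \<subseteq>
          (\<Union>m\<in>B. Poly_Mapping.keys (mono_deriv m f))"
        using keys_diff_act[of p f] p(1) by fastforce
      moreover have "Poly_Mapping.keys (mono_deriv b f) \<inter> Poly_Mapping.keys (mono_deriv c f) = {}"
        if "c \<in> B" for c
        using insert.prems(3)[of b c] insert.hyps(2) that by blast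
      ultimately have "Poly_Mapping.keys (mono_deriv b f) = {}" by blast
      then show False using insert.prems(2)[of b] by simp
    qed
    moreover have "G.dimension (card B) (algebra_scalars V f) ?E"
      using insert.prems by (intro insert.IH) auto
    ultimately have "G.dimension (Suc (card B)) (algebra_scalars V f)
        (G.line_extension (algebra_scalars V f) (?r ?b) ?E)"
      using b_carrier by (intro G.dimension.Suc_dim) auto
    moreover have "G.line_extension (algebra_scalars V f) (?r ?b) ?E =
        ?r ` {p. Poly_Mapping.keys p \<subseteq> insert b B}" (is "?L = ?R")
    proof -
      have combination: "?r (mconst c) \<otimes>\<^bsub>?G\<^esub> ?r ?b \<oplus>\<^bsub>?G\<^esub> ?r p = ?r (Poly_Mapping.single b c + p)"
        if "Poly_Mapping.keys p \<subseteq> B" for c p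
      proof -
        have "p \<in> carrier ?Q" using that by (intro carrier) auto
        then have "?r (mconst c \<otimes>\<^bsub>?Q\<^esub> ?b \<oplus>\<^bsub>?Q\<^esub> p) =
            ?r (mconst c) \<otimes>\<^bsub>?G\<^esub> ?r ?b \<oplus>\<^bsub>?G\<^esub> ?r p"
          using b_carrier mconst_carrier[of c] Q.m_closed by simp
        then show ?thesis by (simp add: mpoly_ring_simps mconst_def mult_single)
      qed
      show ?thesis
      proof (intro equalityI subsetI)
        fix x assume "x \<in> ?L"
        then obtain c p where cp: "Poly_Mapping.keys p \<subseteq> B"
            "x = ?r (mconst c) \<otimes>\<^bsub>?G\<^esub> ?r ?b \<oplus>\<^bsub>?G\<^esub> ?r p"
          by (auto simp: G.line_extension_mem_iff algebra_scalars_def)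
        have "Poly_Mapping.keys (Poly_Mapping.single b c + p) \<subseteq> insert b B"
          using Poly_Mapping.keys_add[of "Poly_Mapping.single b c" p] cp(1)
          by (auto split: if_splits)
        then show "x \<in> ?R" using combination[OF cp(1)] cp(2) by auto
      next
        fix x assume "x \<in> ?R"
        then obtain q where q: "Poly_Mapping.keys q \<subseteq> insert b B" "x = ?r q" by blast
        \<comment> \<open>Removing the \<open>b\<close>-term of \<open>q\<close> leaves the part
          supported on \<open>B\<close>, and the removed coefficient is the scalar of the line
          extension.\<close>
        define p where "p = q - Poly_Mapping.single b (Poly_Mapping.lookup q b)"
        have "Poly_Mapping.keys p \<subseteq> B"
          using q(1) by (auto simp: p_def in_keys_iff lookup_minus lookup_single when_def split: if_splits)
        moreover have "q = Poly_Mapping.single b (Poly_Mapping.lookup q b) + p"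
          by (simp add: p_def)
        ultimately show "x \<in> ?L"
          using combination[of p "Poly_Mapping.lookup q b"] q(2)
          by (auto simp: G.line_extension_mem_iff algebra_scalars_def)
      qed
    qed
    ultimately show ?case using insert.hyps by simp
  qed
qed

lemma sum_single_lookup:
  "(\<Sum>m\<in>Poly_Mapping.keys p. Poly_Mapping.single m (Poly_Mapping.lookup p m)) = p"
  by (rule poly_mapping_eqI)
    (auto simp: lookup_sum lookup_single when_def in_keys_iff)

text \<open>Monomials with equal derivatives have equal residue classes, and those with derivative 0
  have class 0. One monomial for each element of \<open>D\<close> therefore spans the component, and
  disjoint supports make these monomials independent. The hypothesis \<open>f \<noteq> 0\<close>
  makes the scalars a subfield, so that the dimension is unique.\<close>

lemma hilbert_function_eq_card:
  fixes f :: "('v, 'k::field) mpoly" and V :: "'v set" and k :: nat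
  defines "D \<equiv> {mono_deriv m f |m. Poly_Mapping.keys m \<subseteq> V \<and> mono_degree m = k} - {0}"
  assumes "f \<noteq> 0" and finite: "finite (D)"
    and disjoint: "\<And>g h. g \<in> D \<Longrightarrow> h \<in> D \<Longrightarrow> g \<noteq> h \<Longrightarrow>
      Poly_Mapping.keys g \<inter> Poly_Mapping.keys h = {}"
  shows "hilbert_function V f k = card D"
proof -
  interpret G: cring "gorenstein_algebra V f" by (rule cring_gorenstein_algebra)
  have "\<forall>g\<in>D. \<exists>m. Poly_Mapping.keys m \<subseteq> V \<and> mono_degree m = k \<and> mono_deriv m f = g"
    by (auto simp: D_def)
  then obtain e where e: "\<And>g. g \<in> D \<Longrightarrow>
      Poly_Mapping.keys (e g) \<subseteq> V \<and> mono_degree (e g) = k \<and> mono_deriv (e g) f = g"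
    by metis
  define B where "B = e ` D"
  have "inj_on e (D)" using e by (metis inj_onI)
  then have card: "card B = card D" by (simp add: B_def card_image)
  have carrier: "p \<in> carrier (mpoly_ring V)" if "Poly_Mapping.keys p \<subseteq> B" for p
    using that e by (force simp: B_def mpoly_ring_simps mvars_def)
  have dim: "G.dimension (card B) (algebra_scalars V f)
      (residue_class V f ` {p. Poly_Mapping.keys p \<subseteq> B})"
  proof (rule dimension_residue_classes)
    show "finite B" by (simp add: B_def finite)
  next
    fix b assume "b \<in> B"
    then obtain g where "b = e g" "g \<in> D" by (auto simp: B_def)
    moreover from this have "g \<noteq> 0" by (simp add: D_def)
    ultimately show "Poly_Mapping.keys b \<subseteq> V" "mono_deriv b f \<noteq> 0"
      using e by simp_all
  next
    fix b c assume "b \<in> B" "c \<in> B" "b \<noteq> c"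
    then obtain g h where "b = e g" "c = e h" "g \<in> D" "h \<in> D" "g \<noteq> h"
      by (auto simp: B_def)
    then show "Poly_Mapping.keys (mono_deriv b f) \<inter> Poly_Mapping.keys (mono_deriv c f) = {}"
      using e disjoint by simp
  qed
  have "algebra_component V f k = residue_class V f ` {p. Poly_Mapping.keys p \<subseteq> B}"
    unfolding algebra_component_def
  proof (intro equalityI image_subsetI)
    fix p :: "('v, 'k) mpoly" assume p: "p \<in> homogeneous_polys V k"
    \<comment> \<open>The term of \<open>p\<close> at \<open>m\<close> is moved to the chosen
      monomial with the same derivative, or dropped if that derivative is 0. The action on
      \<open>f\<close> does not change, so the sum \<open>q\<close> represents the class of
      \<open>p\<close>.\<close>
    define t where "t m = (if mono_deriv m f = 0 then 0 else
        Poly_Mapping.single (e (mono_deriv m f)) (Poly_Mapping.lookup p m))" for m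
    define q where "q = (\<Sum>m\<in>Poly_Mapping.keys p. t m)"
    have in_D: "mono_deriv m f \<in> D" if "m \<in> Poly_Mapping.keys p" "mono_deriv m f \<noteq> 0" for m
      using that p unfolding D_def homogeneous_polys_def mpoly_ring_simps mvars_def by blast
    have "Poly_Mapping.keys (t m) \<subseteq> B" if "m \<in> Poly_Mapping.keys p" for m
      using in_D[OF that] by (auto simp: t_def B_def)
    then have q: "Poly_Mapping.keys q \<subseteq> B"
      unfolding q_def using keys_sum[of t "Poly_Mapping.keys p"] by blast
    have "diff_act (t m) f =
        diff_act (Poly_Mapping.single m (Poly_Mapping.lookup p m)) f"
      if "m \<in> Poly_Mapping.keys p" for m
      using in_D[OF that] e by (auto simp: t_def diff_act_single diff_act_0l)
    then have "diff_act q f =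
        diff_act (\<Sum>m\<in>Poly_Mapping.keys p. Poly_Mapping.single m (Poly_Mapping.lookup p m)) f"
      unfolding q_def diff_act_sum by (rule sum.cong[OF refl])
    then have "diff_act p f = diff_act q f" by (simp add: sum_single_lookup)
    moreover have "p \<in> carrier (mpoly_ring V)" using p by (simp add: homogeneous_polys_def)
    ultimately have "residue_class V f p = residue_class V f q"
      using residue_class_eq_iff carrier[OF q] by blast
    then show "residue_class V f p \<in> residue_class V f ` {p. Poly_Mapping.keys p \<subseteq> B}"
      using q by blast
  next
    fix p :: "('v, 'k) mpoly" assume "p \<in> {p. Poly_Mapping.keys p \<subseteq> B}"
    then have "p \<in> homogeneous_polys V k"
      using carrier e by (auto simp: homogeneous_polys_def B_def)
    then show "residue_class V f p \<in> residue_class V f ` homogeneous_polys V k" by blast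
  qed
  then show ?thesis
    unfolding hilbert_function_def
    using G.dimI[OF subfield_algebra_scalars[OF \<open>f \<noteq> 0\<close>] dim] card by (simp add: over_def)
qed


section \<open>Square-free monomials\<close>

definition sqfree_mono :: "'v set \<Rightarrow> 'v \<Rightarrow>\<^sub>0 nat" where
  "sqfree_mono S = (\<Sum>v\<in>S. Poly_Mapping.single v 1)"

lemma lookup_sqfree_mono:
  "finite S \<Longrightarrow> Poly_Mapping.lookup (sqfree_mono S) v = of_bool (v \<in> S)"
  by (simp add: sqfree_mono_def lookup_sum lookup_single when_def)

lemma keys_sqfree_mono: "finite S \<Longrightarrow> Poly_Mapping.keys (sqfree_mono S) = S"
  by (auto simp: in_keys_iff lookup_sqfree_mono)

lemma mono_degree_sqfree_mono: "finite S \<Longrightarrow> mono_degree (sqfree_mono S) = card S"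
  by (simp add: mono_degree_def keys_sqfree_mono lookup_sqfree_mono)

lemma sqfree_mono_eq_iff:
  "finite S \<Longrightarrow> finite T \<Longrightarrow> sqfree_mono S = sqfree_mono T \<longleftrightarrow> S = T"
  by (metis keys_sqfree_mono)

lemma sqfree_mono_union:
  "finite S \<Longrightarrow> finite T \<Longrightarrow> S \<inter> T = {} \<Longrightarrow> sqfree_mono S + sqfree_mono T = sqfree_mono (S \<union> T)"
  by (simp add: sqfree_mono_def sum.union_disjoint)

text \<open>The exponents of \<open>m\<close> and \<open>r\<close> at a variable sum to 1 on
  \<open>T\<close> and to 0 elsewhere, so each variable of \<open>T\<close> belongs to exactly one
  of the two factors.\<close>

lemma sqfree_mono_factor:
  assumes "finite T" "m + r = sqfree_mono T"
  obtains S where "S \<subseteq> T" "m = sqfree_mono S" "r = sqfree_mono (T - S)"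
proof
  have *: "Poly_Mapping.lookup m v + Poly_Mapping.lookup r v = of_bool (v \<in> T)" for v
    using assms by (metis lookup_add lookup_sqfree_mono)
  then show sub: "Poly_Mapping.keys m \<subseteq> T"
    by (smt (verit) add_is_0 in_keys_iff of_bool_eq(1) subsetI)
  show "m = sqfree_mono (Poly_Mapping.keys m)"
  proof (rule poly_mapping_eqI)
    fix v
    show "Poly_Mapping.lookup m v = Poly_Mapping.lookup (sqfree_mono (Poly_Mapping.keys m)) v"
      using *[of v]
      by (auto simp: lookup_sqfree_mono in_keys_iff of_bool_def add_is_1 split: if_splits)
  qed
  show "r = sqfree_mono (T - Poly_Mapping.keys m)"
  proof (rule poly_mapping_eqI)
    fix v
    show "Poly_Mapping.lookup r v = Poly_Mapping.lookup (sqfree_mono (T - Poly_Mapping.keys m)) v"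
      using *[of v] assms(1)
      by (auto simp: lookup_sqfree_mono in_keys_iff of_bool_def add_is_1 split: if_splits)
  qed
qed

lemma prod_mvar: "finite S \<Longrightarrow> (\<Prod>v\<in>S. mvar v) = Poly_Mapping.single (sqfree_mono S) 1"
  by (induction S rule: finite_induct) (simp_all add: sqfree_mono_def mvar_def mult_single)

text \<open>Raises one exponent by one at each step, which fits iterated differentiation by single
  variables.\<close>

lemma exponent_induct [case_names zero single]:
  fixes m :: "'v \<Rightarrow>\<^sub>0 nat"
  assumes "P 0" "\<And>v m. P m \<Longrightarrow> P (Poly_Mapping.single v 1 + m)"
  shows "P m"
proof (induction m rule: update_induct)
  case const
  show ?case by (rule assms(1))
next
  case (update m v n)
  have "Poly_Mapping.update v n m = Poly_Mapping.single v n + m"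
    using update by (intro poly_mapping_eqI)
      (auto simp: lookup_update lookup_add lookup_single in_keys_iff when_def)
  moreover have "P (Poly_Mapping.single v n + m)"
  proof (induction n)
    case (Suc n)
    then have "P (Poly_Mapping.single v 1 + (Poly_Mapping.single v n + m))" by (rule assms(2))
    then show ?case by (simp add: add.assoc[symmetric] single_add[symmetric])
  qed (simp add: update)
  ultimately show ?case by simp
qed

text \<open>For a square-free polynomial the numerical factors produced by differentiation are 1
  wherever the coefficient is nonzero, so a derivative only shifts exponents.\<close>

lemma lookup_mono_deriv_sqfree:
  fixes f :: "('v, 'k::comm_ring_1) mpoly"
  assumes "\<And>e v. e \<in> Poly_Mapping.keys f \<Longrightarrow> Poly_Mapping.lookup e v \<le> 1"
  shows "Poly_Mapping.lookup (mono_deriv m f) r = Poly_Mapping.lookup f (m + r)"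
proof (induction m arbitrary: r rule: exponent_induct)
  case zero
  show ?case by (simp add: mono_deriv_def)
next
  case (single v m)
  let ?s = "Poly_Mapping.single v (1::nat)"
  have "mono_deriv (?s + m) f = mpderiv v (mono_deriv m f)"
    using diff_act_mvar[of v "mono_deriv m f"]
    by (simp add: mono_deriv_add mvar_def diff_act_single mconst_simps)
  then have *: "Poly_Mapping.lookup (mono_deriv (?s + m) f) r =
      of_nat (Suc (Poly_Mapping.lookup r v)) * Poly_Mapping.lookup f (?s + m + r)"
    by (simp add: lookup_mpderiv single.IH ac_simps)
  show ?case
  \<comment> \<open>If this exponent occurs in \<open>f\<close>, then \<open>?s\<close> already uses
    up the single allowed power of \<open>v\<close>. Hence \<open>r\<close> does not contain
    \<open>v\<close> and the factor is \<open>Suc 0\<close>.\<close>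
  proof (cases "?s + m + r \<in> Poly_Mapping.keys f")
    case True
    then have "Poly_Mapping.lookup r v = 0"
      using assms[of "?s + m + r" v] by (simp add: lookup_add)
    with * show ?thesis by simp
  next
    case False
    with * show ?thesis by (simp add: in_keys_iff)
  qed
qed


section \<open>Algebras of pure simplicial complexes\<close>

definition facet_term :: "'a set \<Rightarrow> 'a cvar set" where
  "facet_term F = insert (FacetVar F) (VertexVar ` F)"

lemma finite_facet_term: "finite F \<Longrightarrow> finite (facet_term F)"
  by (simp add: facet_term_def)

lemma card_facet_term: "finite F \<Longrightarrow> card (facet_term F) = Suc (card F)"
  unfolding facet_term_def by (subst card_insert_disjoint) (auto simp: card_image inj_on_def)

text \<open>A facet variable identifies its term; all separation of supports below rests on
  this.\<close>

lemma FacetVar_in_facet_term_iff: "FacetVar G \<in> facet_term F \<longleftrightarrow> G = F"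
  by (auto simp: facet_term_def)

lemma face_subset_facet:
  assumes "simplicial_complex V \<Delta>" "S \<in> \<Delta>"
  obtains F where "F \<in> facets \<Delta>" "S \<subseteq> F"
proof -
  have "finite \<Delta>"
    using assms(1) unfolding simplicial_complex_def by (meson finite_Pow_iff finite_subset)
  then obtain F where "F \<in> \<Delta>" "S \<subseteq> F" "\<forall>G\<in>\<Delta>. F \<subseteq> G \<longrightarrow> F = G"
    using finite_has_maximal2[of \<Delta> S] assms(2) by auto
  then show ?thesis by (intro that[of F]) (auto simp: facets_def)
qed

text \<open>Different facets give different monomials because of their facet variables, so no
  coefficients add up.\<close>

lemma lookup_complex_poly:
  assumes "finite (facets \<Delta>)" "\<And>F. F \<in> facets \<Delta> \<Longrightarrow> finite F"
  shows "Poly_Mapping.lookup (complex_poly \<Delta> :: ('a cvar, 'k::comm_ring_1) mpoly) e =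
    of_bool (\<exists>F\<in>facets \<Delta>. e = sqfree_mono (facet_term F))"
proof -
  have "mvar (FacetVar F) * (\<Prod>u\<in>F. mvar (VertexVar u)) =
      (Poly_Mapping.single (sqfree_mono (facet_term F)) 1 :: ('a cvar, 'k) mpoly)"
    if "F \<in> facets \<Delta>" for F
  proof -
    have "(\<Prod>v\<in>facet_term F. mvar v) = mvar (FacetVar F) * (\<Prod>u\<in>F. mvar (VertexVar u))"
      using assms(2)[OF that] unfolding facet_term_def
      by (subst prod.insert) (auto simp: prod.reindex inj_on_def)
    then show ?thesis using prod_mvar[OF finite_facet_term] assms(2)[OF that] by metis
  qed
  then have "complex_poly \<Delta> =
      (\<Sum>F\<in>facets \<Delta>. Poly_Mapping.single (sqfree_mono (facet_term F)) 1 :: ('a cvar, 'k) mpoly)"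
    unfolding complex_poly_def by (rule sum.cong[OF refl])
  then have *: "Poly_Mapping.lookup (complex_poly \<Delta> :: ('a cvar, 'k) mpoly) e =
      (\<Sum>F\<in>facets \<Delta>. of_bool (e = sqfree_mono (facet_term F)))"
    by (simp add: lookup_sum lookup_single when_def of_bool_def eq_commute)
  show ?thesis
  proof (cases "\<exists>F\<in>facets \<Delta>. e = sqfree_mono (facet_term F)")
    case True
    then obtain F where F: "F \<in> facets \<Delta>" "e = sqfree_mono (facet_term F)" by blast
    have "G = F" if "G \<in> facets \<Delta>" "e = sqfree_mono (facet_term G)" for G
      using that F assms(2)
      by (metis FacetVar_in_facet_term_iff finite_facet_term sqfree_mono_eq_iff)
    then have "(\<Sum>G\<in>facets \<Delta>. of_bool (e = sqfree_mono (facet_term G))) =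
        (\<Sum>G\<in>facets \<Delta>. if G = F then 1 else 0 :: 'k)"
      using F by (intro sum.cong) auto
    also have "\<dots> = 1" using assms(1) F by simp
    finally show ?thesis using * True by simp
  next
    case False
    then have "(\<Sum>G\<in>facets \<Delta>. of_bool (e = sqfree_mono (facet_term G)) :: 'k) = 0"
      by (intro sum.neutral) auto
    then show ?thesis using * False by simp
  qed
qed

text \<open>By purity every term of the polynomial has degree \<open>Suc n\<close>. Hence a monomial
  of degree \<open>k\<close> that contains a facet variable and divides a term leaves
  \<open>Suc n - k\<close> vertices, which gives the second summand; monomials in vertex variables
  alone give the first.\<close>

theorem complex_hilbert_eq_faces:
  assumes complex: "simplicial_complex V \<Delta>" and "\<Delta> \<noteq> {}"
    and pure: "\<And>F. F \<in> facets \<Delta> \<Longrightarrow> card F = n" and "k \<le> Suc n"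
  shows "complex_hilbert TYPE('k::field_char_0) V \<Delta> k =
    card {S \<in> \<Delta>. card S = k} + card {S \<in> \<Delta>. card S = Suc n - k}"
proof -
  define f where "f = (complex_poly \<Delta> :: ('a cvar, 'k) mpoly)"
  define D where "D = {mono_deriv m f |m. Poly_Mapping.keys m \<subseteq> complex_vars V \<Delta> \<and>
    mono_degree m = k} - {0}"
  define vm where "vm S = sqfree_mono (VertexVar ` S :: 'a cvar set)" for S
  define d1 where "d1 S = mono_deriv (vm S) f" for S
  define d2 where "d2 S = (Poly_Mapping.single (vm S) 1 :: ('a cvar, 'k) mpoly)" for S
  define A1 where "A1 = {S \<in> \<Delta>. card S = k}"
  define A2 where "A2 = {S \<in> \<Delta>. card S = Suc n - k}"
  have finV: "finite V" and finD: "finite \<Delta>" and sub: "\<And>F. F \<in> \<Delta> \<Longrightarrow> F \<subseteq> V"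
    and down: "\<And>F G. F \<in> \<Delta> \<Longrightarrow> G \<subseteq> F \<Longrightarrow> G \<in> \<Delta>"
    using complex finite_subset[of \<Delta> "Pow V"] by (auto simp: simplicial_complex_def)
  have fin: "finite F" if "F \<in> \<Delta>" for F using sub[OF that] finV by (rule finite_subset)
  have facets_sub: "facets \<Delta> \<subseteq> \<Delta>" by (auto simp: facets_def)
  have finA: "finite A1" "finite A2" by (auto simp: A1_def A2_def finD)
  have f: "Poly_Mapping.lookup f e = of_bool (\<exists>F\<in>facets \<Delta>. e = sqfree_mono (facet_term F))" for e
    unfolding f_def using facets_sub finD fin by (intro lookup_complex_poly) (auto intro: finite_subset)
  have fin_term: "finite (facet_term F)" if "F \<in> facets \<Delta>" for F
    using that facets_sub fin by (auto intro: finite_facet_term)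
  have deriv: "Poly_Mapping.lookup (mono_deriv m f) r =
      of_bool (\<exists>F\<in>facets \<Delta>. m + r = sqfree_mono (facet_term F))" for m r
    by (subst lookup_mono_deriv_sqfree)
      (auto simp: f in_keys_iff lookup_sqfree_mono fin_term)
  have keys_deriv: "r \<in> Poly_Mapping.keys (mono_deriv m f) \<longleftrightarrow>
      (\<exists>F\<in>facets \<Delta>. m + r = sqfree_mono (facet_term F))" for m r
    by (simp add: in_keys_iff deriv)
  have lookup_vm: "Poly_Mapping.lookup (vm S) (FacetVar F) = 0" if "S \<in> \<Delta>" for S F
    using fin[OF that] by (auto simp: vm_def lookup_sqfree_mono)
  have keys_d2: "Poly_Mapping.keys (d2 S) = {vm S}" for S
    by (simp add: d2_def)
  \<comment> \<open>Differentiation by vertex variables leaves the facet variable of every surviving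
    term in place.\<close>
  have keys_d1: "\<exists>F\<in>facets \<Delta>. Poly_Mapping.lookup r (FacetVar F) = 1 \<and>
      vm S + r = sqfree_mono (facet_term F)"
    if S: "S \<in> \<Delta>" and r: "r \<in> Poly_Mapping.keys (d1 S)" for S r
  proof -
    obtain F where F: "F \<in> facets \<Delta>" "vm S + r = sqfree_mono (facet_term F)"
      using r by (auto simp: d1_def keys_deriv)
    have "Poly_Mapping.lookup (vm S + r) (FacetVar F) = 1"
      by (simp add: F lookup_sqfree_mono fin_term FacetVar_in_facet_term_iff)
    then have "Poly_Mapping.lookup r (FacetVar F) = 1"
      using lookup_vm[OF S] by (simp add: lookup_add)
    then show ?thesis using F by blast
  qed
  have vm_inj: "S = T" if "S \<in> \<Delta>" "T \<in> \<Delta>" "vm S = vm T" for S T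
  proof -
    have "VertexVar ` S = (VertexVar ` T :: 'a cvar set)"
      using that fin by (metis finite_imageI sqfree_mono_eq_iff vm_def)
    then show ?thesis by (auto simp: image_iff set_eq_iff)
  qed
  have split: "vm S + sqfree_mono (facet_term F - VertexVar ` S) = sqfree_mono (facet_term F)"
    if "F \<in> facets \<Delta>" "S \<subseteq> F" for F S
  proof -
    have "VertexVar ` S \<subseteq> facet_term F" using that by (auto simp: facet_term_def)
    then show ?thesis
      using fin_term[OF that(1)] unfolding vm_def
      by (subst sqfree_mono_union) (auto intro: finite_subset simp: Un_absorb1)
  qed
  have d1_nonzero: "d1 S \<noteq> 0" if "S \<in> \<Delta>" for S
  proof -
    obtain F where "F \<in> facets \<Delta>" "S \<subseteq> F" using face_subset_facet[OF complex \<open>S \<in> \<Delta>\<close>] .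
    then show ?thesis using split unfolding d1_def by (metis keys_deriv keys_zero empty_iff)
  qed
  \<comment> \<open>The facet variable in \<open>r\<close> determines the term, and cancelling
    \<open>r\<close> from that term recovers the face.\<close>
  have disj1: "S = T"
    if ST: "S \<in> \<Delta>" "T \<in> \<Delta>" and r: "r \<in> Poly_Mapping.keys (d1 S)" "r \<in> Poly_Mapping.keys (d1 T)"
    for S T r
  proof -
    obtain F where F: "F \<in> facets \<Delta>" "Poly_Mapping.lookup r (FacetVar F) = 1"
        "vm S + r = sqfree_mono (facet_term F)" using keys_d1[OF ST(1) r(1)] by blast
    obtain G where G: "G \<in> facets \<Delta>" "vm T + r = sqfree_mono (facet_term G)"
      using keys_d1[OF ST(2) r(2)] by blast
    have "Poly_Mapping.lookup (vm T + r) (FacetVar F) \<noteq> 0"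
      using F lookup_vm[OF ST(2)] by (simp add: lookup_add)
    then have "F = G"
      by (simp add: G lookup_sqfree_mono fin_term FacetVar_in_facet_term_iff)
    then have "vm S = vm T" using F G by (metis add_right_cancel)
    then show ?thesis using vm_inj ST by blast
  qed
  have disj12: "Poly_Mapping.keys (d1 S) \<inter> Poly_Mapping.keys (d2 T) = {}"
    if "S \<in> \<Delta>" "T \<in> \<Delta>" for S T
    using keys_d1[OF that(1)] lookup_vm[OF that(2)] by (fastforce simp: d2_def)
  \<comment> \<open>Here \<open>m\<close> contains the facet variable of \<open>F\<close>, so every
    other term is killed and a single monomial remains.\<close>
  have facet_deriv: "mono_deriv m f = d2 T"
    if F: "F \<in> facets \<Delta>" and T: "T \<subseteq> F" and m: "m + vm T = sqfree_mono (facet_term F)" for m F T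
  proof (rule poly_mapping_eqI)
    fix r
    have TD: "T \<in> \<Delta>" using T F facets_sub down by blast
    have "Poly_Mapping.lookup (m + vm T) (FacetVar F) = 1"
      by (simp add: m lookup_sqfree_mono fin_term F FacetVar_in_facet_term_iff)
    then have m1: "Poly_Mapping.lookup m (FacetVar F) = 1"
      using lookup_vm[OF TD] by (simp add: lookup_add)
    have "(\<exists>G\<in>facets \<Delta>. m + r = sqfree_mono (facet_term G)) \<longleftrightarrow> r = vm T"
    proof
      assume "\<exists>G\<in>facets \<Delta>. m + r = sqfree_mono (facet_term G)"
      then obtain G where G: "G \<in> facets \<Delta>" "m + r = sqfree_mono (facet_term G)" by blast
      have "Poly_Mapping.lookup (m + r) (FacetVar F) \<noteq> 0" using m1 by (simp add: lookup_add)
      then have "F = G"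
        by (simp add: G lookup_sqfree_mono fin_term FacetVar_in_facet_term_iff)
      then show "r = vm T" using G m by (metis add_left_cancel)
    qed (use F m in blast)
    then show "Poly_Mapping.lookup (mono_deriv m f) r = Poly_Mapping.lookup (d2 T) r"
      by (auto simp: deriv d2_def lookup_single when_def)
  qed
  have D_eq: "D = d1 ` A1 \<union> d2 ` A2"
  proof (intro equalityI subsetI)
    fix g assume "g \<in> D"
    then obtain m where m: "g = mono_deriv m f" "mono_degree m = k" "mono_deriv m f \<noteq> 0"
      by (auto simp: D_def)
    then obtain r where "r \<in> Poly_Mapping.keys (mono_deriv m f)" by fastforce
    then obtain F where F: "F \<in> facets \<Delta>" "m + r = sqfree_mono (facet_term F)"
      by (auto simp: keys_deriv)
    then obtain S where S: "S \<subseteq> facet_term F" "m = sqfree_mono S"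
        "r = sqfree_mono (facet_term F - S)"
      using sqfree_mono_factor[OF fin_term] by metis
    have finS: "finite S" using S(1) fin_term[OF F(1)] by (rule finite_subset)
    then have card_S: "card S = k" using m S by (simp add: mono_degree_sqfree_mono)
    have FD: "F \<in> \<Delta>" using F facets_sub by blast
    show "g \<in> d1 ` A1 \<union> d2 ` A2"
    \<comment> \<open>The two families correspond to whether the facet variable is among the
      variables differentiated by. In the first case \<open>T\<close> collects the vertices left
      over, in the second the vertices differentiated by.\<close>
    proof (cases "FacetVar F \<in> S")
      case True
      define T where "T = {u \<in> F. VertexVar u \<notin> S}"
      have T: "facet_term F - S = VertexVar ` T"
        using True by (auto simp: facet_term_def T_def)
      then have "card T = card (facet_term F - S)" by (simp add: card_image inj_on_def)
      also have "\<dots> = Suc n - k"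
        using finS S(1) card_S F pure fin[OF FD]
        by (simp add: card_Diff_subset card_facet_term)
      finally have "T \<in> A2" using down[OF FD, of T] by (auto simp: A2_def T_def)
      moreover have "g = d2 T"
        unfolding m(1) by (rule facet_deriv[OF F(1)]) (use F S T in \<open>auto simp: T_def vm_def\<close>)
      ultimately show ?thesis by blast
    next
      case False
      define T where "T = {u \<in> F. VertexVar u \<in> S}"
      have T: "S = VertexVar ` T"
        using False S(1) by (auto simp: facet_term_def T_def)
      then have "card T = k" using card_S by (simp add: card_image inj_on_def)
      then have "T \<in> A1" using down[OF FD, of T] by (auto simp: A1_def T_def)
      moreover have "g = d1 T" unfolding m(1) d1_def vm_def T[symmetric] S(2) ..
      ultimately show ?thesis by blast
    qed
  next
    fix g assume "g \<in> d1 ` A1 \<union> d2 ` A2"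
    then consider S where "S \<in> A1" "g = d1 S" | T where "T \<in> A2" "g = d2 T" by blast
    then show "g \<in> D"
    proof cases
      case (1 S)
      then have S: "S \<in> \<Delta>" "card S = k" by (auto simp: A1_def)
      then have "Poly_Mapping.keys (vm S) \<subseteq> complex_vars V \<Delta>" "mono_degree (vm S) = k"
        using fin[OF S(1)] sub[OF S(1)]
        by (auto simp: vm_def keys_sqfree_mono mono_degree_sqfree_mono complex_vars_def
            card_image inj_on_def)
      then show ?thesis
        using 1 d1_nonzero[OF S(1)] by (auto simp: D_def d1_def intro!: exI[of _ "vm S"])
    next
      case (2 T)
      then have T: "T \<in> \<Delta>" "card T = Suc n - k" by (auto simp: A2_def)
      obtain F where F: "F \<in> facets \<Delta>" "T \<subseteq> F" using face_subset_facet[OF complex T(1)] .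
      have FD: "F \<in> \<Delta>" using F facets_sub by blast
      \<comment> \<open>The complement of \<open>T\<close> in the term of \<open>F\<close>. Its
        degree is \<open>Suc n - (Suc n - k)\<close>, which is \<open>k\<close> under truncated
        subtraction because \<open>k \<le> Suc n\<close>.\<close>
      define m where "m = sqfree_mono (facet_term F - VertexVar ` T)"
      have VT: "VertexVar ` T \<subseteq> facet_term F" using F by (auto simp: facet_term_def)
      have "mono_degree m = card (facet_term F) - card (VertexVar ` T :: 'a cvar set)"
        using fin_term[OF F(1)] fin[OF T(1)] VT
        by (simp add: m_def mono_degree_sqfree_mono card_Diff_subset)
      also have "\<dots> = k"
        using T F pure fin[OF FD] \<open>k \<le> Suc n\<close>
        by (simp add: card_facet_term card_image inj_on_def)
      finally have "mono_degree m = k" .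
      moreover have "Poly_Mapping.keys m \<subseteq> complex_vars V \<Delta>"
        using fin_term[OF F(1)] F sub[OF FD]
        by (auto simp: m_def keys_sqfree_mono complex_vars_def facet_term_def)
      moreover have "mono_deriv m f = d2 T"
        using F split[OF F] by (intro facet_deriv) (auto simp: m_def add.commute)
      moreover have "d2 T \<noteq> 0"
        using keys_d2[of T] by auto
      ultimately show ?thesis using 2 by (auto simp: D_def intro!: exI[of _ m])
    qed
  qed
  obtain S0 where S0: "S0 \<in> \<Delta>" using \<open>\<Delta> \<noteq> {}\<close> by blast
  \<comment> \<open>By linearity the zero polynomial has only zero derivatives, whereas
    \<open>d1 S0\<close> is nonzero.\<close>
  then have "f \<noteq> 0" using d1_nonzero[OF S0] mono_deriv_lin(2)[of _ 0 f] by (auto simp: d1_def mconst_simps)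
  have "hilbert_function (complex_vars V \<Delta>) f k = card D"
    unfolding D_def
  proof (rule hilbert_function_eq_card[OF \<open>f \<noteq> 0\<close>], fold D_def)
    show "finite D" unfolding D_eq using finA by blast
    fix g h assume gh: "g \<in> D" "h \<in> D" "g \<noteq> h"
    have "Poly_Mapping.keys (d1 S) \<inter> Poly_Mapping.keys (d1 T) = {}"
      if "S \<in> A1" "T \<in> A1" "d1 S \<noteq> d1 T" for S T
      using disj1[of S T] that by (auto simp: A1_def)
    moreover have "Poly_Mapping.keys (d2 S) \<inter> Poly_Mapping.keys (d2 T) = {}"
      if "d2 S \<noteq> d2 T" for S T
      using that by (auto simp: d2_def)
    moreover have "Poly_Mapping.keys (d1 S) \<inter> Poly_Mapping.keys (d2 T) = {}"
      if "S \<in> A1" "T \<in> A2" for S T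
      using disj12[of S T] that by (simp add: A1_def A2_def)
    moreover from this have "Poly_Mapping.keys (d2 T) \<inter> Poly_Mapping.keys (d1 S) = {}"
      if "S \<in> A1" "T \<in> A2" for S T
      using that by blast
    ultimately show "Poly_Mapping.keys g \<inter> Poly_Mapping.keys h = {}"
      using gh unfolding D_eq by (elim UnE imageE) (auto simp del: disjoint_iff)
  qed
  also have "card D = card (d1 ` A1) + card (d2 ` A2)"
  proof -
    have "d1 ` A1 \<inter> d2 ` A2 = {}"
    proof -
      have "d1 S \<noteq> d2 T" if "S \<in> \<Delta>" "T \<in> \<Delta>" for S T
        using disj12[OF that] d1_nonzero[OF that(1)] by auto
      then show ?thesis by (auto simp: A1_def A2_def)
    qed
    then show ?thesis unfolding D_eq using finA by (intro card_Un_disjoint) auto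
  qed
  also have "card (d1 ` A1) = card A1"
  proof (rule card_image, rule inj_onI)
    \<comment> \<open>A nonzero derivative has some monomial \<open>r\<close> in its support, and a
      shared \<open>r\<close> already forces the faces to agree.\<close>
    fix S T assume "S \<in> A1" "T \<in> A1" "d1 S = d1 T"
    moreover from this obtain r where "r \<in> Poly_Mapping.keys (d1 S)"
      using d1_nonzero[of S] by (fastforce simp: A1_def)
    ultimately show "S = T" using disj1[of S T r] by (simp add: A1_def)
  qed
  also have "card (d2 ` A2) = card A2"
  proof (rule card_image, rule inj_onI)
    fix S T assume "S \<in> A2" "T \<in> A2" "d2 S = d2 T"
    moreover from this have "vm S = vm T"
      using keys_d2[of S] keys_d2[of T] by simp
    ultimately show "S = T" using vm_inj by (simp add: A2_def)
  qed
  finally show ?thesis by (simp add: complex_hilbert_def f_def A1_def A2_def)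
qed


section \<open>Turan complexes\<close>

text \<open>A crude bound: all sets of \<open>j\<close> vertices are counted, whether or not they
  are faces.\<close>

lemma card_turan_faces_le:
  assumes "\<And>i. i \<in> {1..n} \<Longrightarrow> a i \<le> M"
  shows "card {S \<in> turan_complex n a. card S = j} \<le> (n * M) ^ j"
proof -
  let ?V = "turan_vertices n a"
  have fin: "finite ?V" by (simp add: turan_vertices_def)
  have "card ?V \<le> n * M"
    using sum_bounded_above[of "{1..n}" a M] assms by (simp add: turan_vertices_def)
  have "card {S \<in> turan_complex n a. card S = j} \<le> card {S. S \<subseteq> ?V \<and> card S = j}"
    using simplicial_complex_turan[of n a] fin
    by (intro card_mono) (auto simp: simplicial_complex_def)
  also have "\<dots> = card ?V choose j" by (rule n_subsets[OF fin])
  also have "\<dots> \<le> card ?V ^ j"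
    by (rule order_trans[OF _ binomial_fact_pow]) simp
  also have "\<dots> \<le> (n * M) ^ j" using \<open>card ?V \<le> n * M\<close> by (rule power_mono) simp
  finally show ?thesis .
qed

text \<open>It suffices to choose one of the first \<open>m\<close> vertices in each of the first
  \<open>j\<close> parts; distinct choices have distinct graphs.\<close>

lemma card_turan_faces_ge:
  assumes "\<And>i. i \<in> {1..n} \<Longrightarrow> m \<le> a i" "1 \<le> m" "j \<le> n"
  shows "m ^ j \<le> card {S \<in> turan_complex n a. card S = j}"
proof -
  let ?P = "\<Pi>\<^sub>E i\<in>{1..j}. {1..m}"
  define g where "g \<psi> = (\<lambda>i. (i, \<psi> i)) ` {1..j}" for \<psi> :: "nat \<Rightarrow> nat"
  have inj: "inj_on g ?P"
  proof (rule inj_onI)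
    fix \<phi> \<psi> assume *: "\<phi> \<in> ?P" "\<psi> \<in> ?P" "g \<phi> = g \<psi>"
    then show "\<phi> = \<psi>"
      by (intro PiE_ext[OF *(1,2)]) (auto simp: g_def image_iff set_eq_iff)
  qed
  have "g ` ?P \<subseteq> {S \<in> turan_complex n a. card S = j}"
  proof (rule image_subsetI, rule CollectI, rule conjI)
    fix \<psi> assume \<psi>: "\<psi> \<in> ?P"
    \<comment> \<open>Extends the partial choice to a facet by taking vertex 1 in each remaining
      part. The value \<open>undefined\<close> outside \<open>{1..n}\<close> is what membership in
      the extensional product demands.\<close>
    define \<phi> where "\<phi> i = (if i \<in> {1..j} then \<psi> i else if i \<in> {1..n} then 1 else undefined)" for i
    have "\<phi> i \<in> {1..a i}" if "i \<in> {1..n}" for i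
      using PiE_mem[OF \<psi>, of i] assms(1)[OF that] assms(2) that by (auto simp: \<phi>_def)
    moreover have "\<phi> i = undefined" if "i \<notin> {1..n}" for i
      using that assms(3) by (auto simp: \<phi>_def)
    ultimately have "\<phi> \<in> (\<Pi>\<^sub>E i\<in>{1..n}. {1..a i})" by (intro PiE_I)
    moreover have "g \<psi> \<subseteq> (\<lambda>i. (i, \<phi> i)) ` {1..n}"
      using assms(3) by (auto simp: g_def \<phi>_def)
    ultimately show "g \<psi> \<in> turan_complex n a"
      unfolding turan_complex_def turan_facets_def by blast
    show "card (g \<psi>) = j" by (simp add: g_def card_image inj_on_def)
  qed
  moreover have "finite {S \<in> turan_complex n a. card S = j}"
    using simplicial_complex_turan[of n a] finite_subset[of "turan_complex n a" "Pow (turan_vertices n a)"]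
    by (simp add: simplicial_complex_def)
  ultimately have "card (g ` ?P) \<le> card {S \<in> turan_complex n a. card S = j}"
    by (intro card_mono)
  then show ?thesis unfolding card_image[OF inj] by (simp add: card_PiE)
qed

lemma turan_hilbert_eq_faces:
  assumes "\<And>i. i \<in> {1..n} \<Longrightarrow> 1 \<le> a i" "k \<le> Suc n"
  shows "turan_hilbert TYPE('k::field_char_0) n a k =
    card {S \<in> turan_complex n a. card S = k} + card {S \<in> turan_complex n a. card S = Suc n - k}"
proof -
  have "(\<Pi>\<^sub>E i\<in>{1..n}. {1..a i}) \<noteq> {}"
    using assms(1) by (auto simp: PiE_eq_empty_iff)
  then have "turan_complex n a \<noteq> {}" by (auto simp: turan_complex_def turan_facets_def)
  then show ?thesis
    unfolding turan_hilbert_def using simplicial_complex_turan card_turan_facet assms(2)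
    by (intro complex_hilbert_eq_faces) (auto simp: facets_turan_complex)
qed

text \<open>As a function of \<open>m\<close>, the dimension in degree \<open>Suc k\<close> grows at
  most like \<open>m ^ (n - k)\<close>, while the faces with \<open>Suc n - k\<close> vertices alone
  give degree \<open>k\<close> at least \<open>m ^ (Suc n - k)\<close>. The extra factor
  \<open>m\<close> exceeds the constant by \<open>large\<close>.\<close>

lemma turan_hilbert_decreasing:
  assumes bounds: "\<And>i. i \<in> {1..n} \<Longrightarrow> m \<le> a i \<and> a i \<le> 2 * m"
    and large: "2 * (2 * n) ^ n < m" and k: "1 \<le> k" "2 * Suc k \<le> Suc n"
  shows "turan_hilbert TYPE('k::field_char_0) n a (Suc k) < turan_hilbert TYPE('k) n a k"
proof -
  let ?c = "\<lambda>j. card {S \<in> turan_complex n a. card S = j}"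
  have m: "1 \<le> m" "1 \<le> n" using large k by auto
  have pos: "1 \<le> a i" if "i \<in> {1..n}" for i using bounds[OF that] m by simp
  have le: "?c j \<le> (2 * n * m) ^ (n - k)" if "j \<le> n - k" for j
  proof -
    have "?c j \<le> (n * (2 * m)) ^ j" using bounds by (intro card_turan_faces_le) auto
    also have "\<dots> = (2 * n * m) ^ j" by (simp add: ac_simps)
    also have "\<dots> \<le> (2 * n * m) ^ (n - k)" using that m by (intro power_increasing) auto
    finally show ?thesis .
  qed
  have "turan_hilbert TYPE('k) n a (Suc k) = ?c (Suc k) + ?c (Suc n - Suc k)"
    using pos k by (intro turan_hilbert_eq_faces) auto
  also have "\<dots> \<le> 2 * (2 * n * m) ^ (n - k)"
  proof -
    \<comment> \<open>Degree \<open>Suc k\<close> is at most half of the socle degree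
      \<open>Suc n\<close>, so both face sizes \<open>Suc k\<close> and \<open>n - k\<close> are
      covered by \<open>le\<close>.\<close>
    have "Suc k \<le> n - k" using k by simp
    then show ?thesis using le[of "Suc k"] le[of "Suc n - Suc k"] by simp
  qed
  also have "\<dots> = 2 * (2 * n) ^ (n - k) * m ^ (n - k)" by (simp add: power_mult_distrib)
  also have "\<dots> \<le> 2 * (2 * n) ^ n * m ^ (n - k)"
    using m by (intro mult_right_mono mult_left_mono power_increasing) auto
  also have "\<dots> < m * m ^ (n - k)" using large m by simp
  also have "\<dots> = m ^ (Suc n - k)" using k by (simp add: Suc_diff_le)
  \<comment> \<open>The assumption \<open>1 \<le> k\<close> ensures that \<open>Suc n - k\<close>
    does not exceed the facet size \<open>n\<close>.\<close>
  also have "\<dots> \<le> ?c (Suc n - k)" using bounds m k by (intro card_turan_faces_ge) auto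
  also have "\<dots> \<le> turan_hilbert TYPE('k) n a k"
    using pos k by (subst turan_hilbert_eq_faces) auto
  finally show ?thesis .
qed

theorem corollary3p8:
  fixes d :: nat
  assumes "d \<ge> 2"
  shows "\<exists>\<epsilon>>0::real. \<exists>N::nat. \<forall>a :: nat \<Rightarrow> nat.
           (\<forall>i\<in>{1..d - 1}. 2 \<le> a i) \<longrightarrow>
           mono_on {1..d - 1} a \<longrightarrow>
           N \<le> a 1 \<longrightarrow>
           real (a (d - 1)) \<le> (1 + \<epsilon>) * real (a 1) \<longrightarrow>
           (\<forall>k. 1 \<le> k \<and> k < d div 2 \<longrightarrow>
              turan_hilbert TYPE('k::field_char_0) (d - 1) a k
                > turan_hilbert TYPE('k) (d - 1) a (Suc k))"
\<comment> \<open>With \<epsilon> = 1 all part sizes lie between \<open>a 1\<close> and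
  \<open>2 * a 1\<close>. The threshold is one more than the constant in
  \<open>turan_hilbert_decreasing\<close> for \<open>n = d - 1\<close>, so its strict inequality
  holds with \<open>m = a 1\<close>.\<close>
proof (rule exI[of _ 1], rule conjI, simp, rule exI[of _ "Suc (2 * (2 * (d - 1)) ^ (d - 1))"],
    intro allI impI)
  fix a :: "nat \<Rightarrow> nat" and k
  assume mono: "mono_on {1..d - 1} a" and N: "Suc (2 * (2 * (d - 1)) ^ (d - 1)) \<le> a 1"
    and ratio: "real (a (d - 1)) \<le> (1 + 1) * real (a 1)" and k: "1 \<le> k \<and> k < d div 2"
  have upper: "a (d - 1) \<le> 2 * a 1" using ratio by simp
  have "a 1 \<le> a i \<and> a i \<le> 2 * a 1" if "i \<in> {1..d - 1}" for i
  proof -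
    have "a 1 \<le> a i" "a i \<le> a (d - 1)" using that by (auto intro!: mono_onD[OF mono])
    with upper show ?thesis by simp
  qed
  then show "turan_hilbert TYPE('k) (d - 1) a (Suc k) < turan_hilbert TYPE('k) (d - 1) a k"
    using N k by (intro turan_hilbert_decreasing[where m = "a 1"]) auto
qed

end
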